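(* Let $R$ be an infinite integral domain that is not homomorphically finite, and let $r_0\in R\setminus\{0\}$ be such that $[R:r_0R]=\infty$. Then $$\widehat{r_0R}\supseteq\overline{K(\beta R\setminus\{0\},\cdot)}\quad\text{and}\quad\widehat{r_0R}\cap\overline{K(\beta R,+)}=\emptyset.$$ In particular, $$\overline{K(\beta R\setminus\{0\},\cdot)}\cap\overline{K(\beta R,+)}=\emptyset.$$
   Context: A ring $R$ is homomorphically finite if for every $r\in R\setminus\{0\}$ the two-sided ideal generated by $r$ is a finite index subgroup of $(R,+)$; $[R:r_0R]$ is the index in $(R,+)$. Integral domains are commutative and, in the paper, rings are not required to have a multiplicative unit. For a set $S$, $\beta S$ is the set of ultrafilters on $S$, with the topology having basis $\hat A=\{p\in\beta S : A\in p\}$, $A\subseteq S$; the overline denotes closure. For a semigroup $(S,\diamond)$, the operation extends to $\beta S$ by: $A\in p\diamond q$ iff $\{s\in S : s^{-1}A\in q\}\in p$, where $s^{-1}A=\{x\in S : s\diamond x\in A\}$; this makes $\beta S$ a compact right topological semigroup, which has a smallest two-sided ideal $K(\beta S,\diamond)$. $\beta R\setminus\{0\}$ is $\beta R$ minus the principal ultrafilter at $0$, identified (topologically and as a semigroup under $\cdot$) with $\beta(R\setminus\{0\})$ via $p\mapsto\{A\subseteq R : A\setminus\{0\}\in p\}$ for $p\in\beta(R\setminus\{0\})$; $K(\beta R\setminus\{0\},\cdot)$ is its smallest ideal, and closures are taken in $\beta R$ (equivalently $\beta R\setminus\{0\}$ for the multiplicative one). *)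

theory Defs
  imports "HOL-Analysis.Elementary_Topology" "HOL-Library.Set_Algebras"
begin

section \<open>Homomorphically finite rings\<close>

text \<open>
  The type class \<^class>\<open>ring\<close> does not require a multiplicative unit, so neither
  the notions below nor the sort \<open>{comm_ring, ring_no_zero_divisors}\<close> (integral domains,
  apart from the trivial ring) do.  In particular an element \<open>r\<close> need not belong to \<open>r *o UNIV\<close>.
\<close>

definition finite_index :: "'a::ab_group_add set \<Rightarrow> bool" where
  "finite_index H \<longleftrightarrow> finite (range (\<lambda>x. x +o H))"

definition two_sided_ring_ideal :: "'a::ring set \<Rightarrow> bool" where
  "two_sided_ring_ideal I \<longleftrightarrow>
     0 \<in> I \<and> (\<forall>x\<in>I. \<forall>y\<in>I. x - y \<in> I) \<and> (\<forall>x\<in>I. \<forall>s. s * x \<in> I \<and> x * s \<in> I)"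

definition homomorphically_finite :: "'a::ring itself \<Rightarrow> bool" where
  "homomorphically_finite _ \<longleftrightarrow>
     (\<forall>r::'a. r \<noteq> 0 \<longrightarrow> finite_index (two_sided_ring_ideal hull {r}))"


section \<open>The space of ultrafilters\<close>

text \<open>\<open>'a ultrafilter\<close> is the space \<open>\<beta>S\<close> for \<open>S\<close> the type \<open>'a\<close>.\<close>

typedef 'a ultrafilter =
  "{F :: 'a filter. F \<noteq> bot \<and> (\<forall>P. eventually P F \<or> eventually (\<lambda>x. \<not> P x) F)}"
  by (rule exI[of _ "principal {undefined}"])
     (auto simp: eventually_principal principal_eq_bot_iff)

definition in_ultrafilter :: "'a set \<Rightarrow> 'a ultrafilter \<Rightarrow> bool" where
  "in_ultrafilter A p \<longleftrightarrow> eventually (\<lambda>x. x \<in> A) (Rep_ultrafilter p)"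

definition hat :: "'a set \<Rightarrow> 'a ultrafilter set" where
  "hat A = {p. in_ultrafilter A p}"

definition principal_ultrafilter :: "'a \<Rightarrow> 'a ultrafilter" where
  "principal_ultrafilter a = Abs_ultrafilter (principal {a})"

lemma in_ultrafilter_principal: "in_ultrafilter A (principal_ultrafilter a) \<longleftrightarrow> a \<in> A"
  unfolding in_ultrafilter_def principal_ultrafilter_def
  by (subst Abs_ultrafilter_inverse) (auto simp: eventually_principal principal_eq_bot_iff)

lemma ultrafilter_eqI:
  assumes "\<And>A. in_ultrafilter A p \<longleftrightarrow> in_ultrafilter A q"
  shows "p = q"
proof -
  have "eventually P (Rep_ultrafilter p) \<longleftrightarrow> eventually P (Rep_ultrafilter q)" for P
    using assms[of "Collect P"] by (simp add: in_ultrafilter_def)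
  then show ?thesis
    by (simp add: filter_eq_iff flip: Rep_ultrafilter_inject)
qed

lemma in_ultrafilter_UNIV: "in_ultrafilter UNIV p"
  by (simp add: in_ultrafilter_def)

lemma in_ultrafilter_Int: "in_ultrafilter (A \<inter> B) p \<longleftrightarrow> in_ultrafilter A p \<and> in_ultrafilter B p"
  by (simp add: in_ultrafilter_def eventually_conj_iff)

lemma in_ultrafilter_Compl: "in_ultrafilter (- A) p \<longleftrightarrow> \<not> in_ultrafilter A p"
proof -
  have "Rep_ultrafilter p \<noteq> bot"
    and 1: "in_ultrafilter A p \<or> in_ultrafilter (- A) p"
    using Rep_ultrafilter[of p] by (auto simp: in_ultrafilter_def)
  then have "\<not> in_ultrafilter (A \<inter> - A) p"
    by (simp add: in_ultrafilter_def)
  then have "\<not> (in_ultrafilter A p \<and> in_ultrafilter (- A) p)"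
    unfolding in_ultrafilter_Int .
  with 1 show ?thesis by blast
qed

instantiation ultrafilter :: (type) topological_space
begin

definition open_ultrafilter :: "'a ultrafilter set \<Rightarrow> bool" where
  "open_ultrafilter U \<longleftrightarrow> (\<exists>\<A>. U = (\<Union>A\<in>\<A>. hat A))"

instance
proof
  show "open (UNIV :: 'a ultrafilter set)"
    unfolding open_ultrafilter_def
    by (rule exI[of _ "{UNIV}"]) (auto simp: hat_def in_ultrafilter_UNIV)
next
  fix U V :: "'a ultrafilter set"
  assume "open U" "open V"
  then obtain \<A> \<B> where "U = (\<Union>A\<in>\<A>. hat A)" "V = (\<Union>B\<in>\<B>. hat B)"
    unfolding open_ultrafilter_def by blast
  then have "U \<inter> V = (\<Union>C\<in>(\<lambda>(A, B). A \<inter> B) ` (\<A> \<times> \<B>). hat C)"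
    by (auto simp: hat_def in_ultrafilter_Int)
  then show "open (U \<inter> V)"
    unfolding open_ultrafilter_def by blast
next
  fix K :: "'a ultrafilter set set"
  assume K: "\<forall>U\<in>K. open U"
  have "\<Union>K = (\<Union>A\<in>{A. hat A \<subseteq> \<Union>K}. hat A)"
  proof (rule equalityI; rule subsetI)
    fix p assume "p \<in> \<Union>K"
    then obtain U where U: "U \<in> K" "p \<in> U" by blast
    with K obtain \<A> where \<A>: "U = (\<Union>A\<in>\<A>. hat A)"
      unfolding open_ultrafilter_def by blast
    with U obtain A where "A \<in> \<A>" "p \<in> hat A" by blast
    moreover from this \<A> U have "hat A \<subseteq> \<Union>K" by blast
    ultimately show "p \<in> (\<Union>A\<in>{A. hat A \<subseteq> \<Union>K}. hat A)" by blast
  qed blast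
  then show "open (\<Union>K)"
    unfolding open_ultrafilter_def by blast
qed

end


section \<open>Extending a binary operation to ultrafilters\<close>

definition ext_op :: "('a \<Rightarrow> 'a \<Rightarrow> 'a) \<Rightarrow> 'a ultrafilter \<Rightarrow> 'a ultrafilter \<Rightarrow> 'a ultrafilter" where
  "ext_op f p q = Abs_ultrafilter (Abs_filter (\<lambda>P.
     eventually (\<lambda>s. eventually (\<lambda>x. P (f s x)) (Rep_ultrafilter q)) (Rep_ultrafilter p)))"

lemma in_ultrafilter_ext_op:
  "in_ultrafilter A (ext_op f p q) \<longleftrightarrow>
     in_ultrafilter {s. in_ultrafilter {x. f s x \<in> A} q} p"
proof -
  define E where "E P \<longleftrightarrow>
     eventually (\<lambda>s. eventually (\<lambda>x. P (f s x)) (Rep_ultrafilter q)) (Rep_ultrafilter p)" for P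
  have "is_filter E"
  proof
    show "E (\<lambda>x. True)" by (simp add: E_def)
  next
    fix P Q assume "E P" "E Q"
    then show "E (\<lambda>x. P x \<and> Q x)"
      by (simp add: E_def eventually_conj_iff)
  next
    fix P Q assume "\<forall>x. P x \<longrightarrow> Q x" "E P"
    then show "E Q"
      unfolding E_def by (auto elim!: eventually_mono)
  qed
  then have ev: "eventually P (Abs_filter E) \<longleftrightarrow> E P" for P
    by (rule eventually_Abs_filter)
  have E_in: "E P \<longleftrightarrow> in_ultrafilter {s. in_ultrafilter {x. P (f s x)} q} p" for P
    by (simp add: E_def in_ultrafilter_def)
  have neg: "E (\<lambda>x. \<not> P x) \<longleftrightarrow> \<not> E P" for P
    by (simp add: E_in Collect_neg_eq in_ultrafilter_Compl)
  have "Abs_filter E \<noteq> bot"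
    using ev[of "\<lambda>x. False"] neg[of "\<lambda>x. True"] by (auto simp: E_def)
  then have "Rep_ultrafilter (Abs_ultrafilter (Abs_filter E)) = Abs_filter E"
    by (intro Abs_ultrafilter_inverse) (auto simp: ev neg)
  then show ?thesis
    using ev[of "\<lambda>x. x \<in> A"] E_in[of "\<lambda>x. x \<in> A"]
    by (simp add: in_ultrafilter_def ext_op_def E_def[abs_def])
qed

text \<open>
  The ultrafilters other than the principal one at \<open>0\<close> are closed under the
  extended multiplication; the resulting semigroup is \<open>\<beta>(R - {0})\<close> viewed inside \<open>\<beta>R\<close>.
\<close>

lemma ext_op_times_neq_principal_0:
  fixes p q :: "'a::ring_no_zero_divisors ultrafilter"
  assumes "p \<noteq> principal_ultrafilter 0" "q \<noteq> principal_ultrafilter 0"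
  shows "ext_op (*) p q \<noteq> principal_ultrafilter 0"
proof -
  have nonprincipal: "\<not> in_ultrafilter {0} u"
    if "u \<noteq> principal_ultrafilter 0" for u :: "'a ultrafilter"
  proof
    assume *: "in_ultrafilter {0} u"
    have "in_ultrafilter A u \<longleftrightarrow> 0 \<in> A" for A
    proof (cases "0 \<in> A")
      case True
      then have "{0} \<inter> A = {0}" by blast
      then show ?thesis
        using * in_ultrafilter_Int[of "{0}" A u] True by simp
    next
      case False
      then have "{0} \<inter> - A = {0}" by blast
      then show ?thesis
        using * in_ultrafilter_Int[of "{0}" "- A" u] False in_ultrafilter_Compl[of A u] by simp
    qed
    then have "u = principal_ultrafilter 0"
      by (intro ultrafilter_eqI) (simp add: in_ultrafilter_principal)
    with that show False ..
  qed
  have "in_ultrafilter {x. s * x \<in> {0}} q \<longleftrightarrow> s \<in> {0}" for s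
    using nonprincipal[OF assms(2)] by (cases "s = 0") (auto simp: in_ultrafilter_UNIV)
  then have "\<not> in_ultrafilter {0} (ext_op (*) p q)"
    using nonprincipal[OF assms(1)] by (simp add: in_ultrafilter_ext_op)
  then show ?thesis
    by (auto simp: in_ultrafilter_principal)
qed


section \<open>The smallest ideal of a semigroup\<close>

text \<open>\<open>S\<close> is the carrier of a semigroup with operation \<open>f\<close>; ideals are nonempty.\<close>

definition two_sided_ideal :: "('b \<Rightarrow> 'b \<Rightarrow> 'b) \<Rightarrow> 'b set \<Rightarrow> 'b set \<Rightarrow> bool" where
  "two_sided_ideal f S I \<longleftrightarrow>
     I \<noteq> {} \<and> I \<subseteq> S \<and> (\<forall>s\<in>S. \<forall>x\<in>I. f s x \<in> I \<and> f x s \<in> I)"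

text \<open>
  This is only meaningful if there is a least two-sided ideal with respect to inclusion,
  which is the case for compact right topological semigroups.
\<close>

definition smallest_ideal :: "('b \<Rightarrow> 'b \<Rightarrow> 'b) \<Rightarrow> 'b set \<Rightarrow> 'b set" where
  "smallest_ideal f S = (LEAST I. two_sided_ideal f S I)"

end

theory Submission
  imports Defs
begin

text \<open>
  Both closures are separated by the clopen set \<^term>\<open>hat (r0 *o UNIV)\<close>, and each half reduces to
  exhibiting one suitable ideal, because the smallest ideal is contained in every ideal.

  Multiplicatively, \<open>r0 R\<close> absorbs multiplication, so the ultrafilters containing it form an ideal
  of \<open>\<beta>R - {0}\<close>.  Being the trace of a closed set, this ideal even catches the closure of the
  smallest one.

  Additively, let \<open>H = r0 R\<close>.  The ultrafilters that contain no coset of \<open>H\<close> form an ideal of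
  \<open>\<beta>R\<close>: a translate of a coset is a coset, and an ultrafilter contains at most one coset.  This
  ideal is nonempty precisely because \<open>H\<close> has infinite index, so that no finitely many cosets cover
  \<open>R\<close>.  Hence the smallest ideal misses the open set of ultrafilters containing \<open>H\<close>, and so does
  its closure.

  What remains is that the smallest ideal, defined as a least element, exists at all.
  The two semigroups are compact Hausdorff and their right translations are continuous, so Zorn's
  lemma yields a minimal closed left ideal; every two-sided ideal contains it, and therefore the
  intersection of all two-sided ideals is nonempty (\<open>smallest_ideal_subset\<close>).
\<close>

section \<open>The smallest ideal of a compact right topological semigroup\<close>

definition closed_left_ideal :: "('b::topological_space \<Rightarrow> 'b \<Rightarrow> 'b) \<Rightarrow> 'b set \<Rightarrow> 'b set \<Rightarrow> bool" where
  "closed_left_ideal f S L \<longleftrightarrow>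
     closed L \<and> L \<noteq> {} \<and> L \<subseteq> S \<and> (\<forall>s\<in>S. \<forall>x\<in>L. f s x \<in> L)"

text \<open>
  Compactness makes the intersection of a chain of nonempty closed left ideals nonempty, as Zorn's
  lemma requires.
\<close>

lemma minimal_closed_left_ideal:
  fixes f :: "'b::topological_space \<Rightarrow> 'b \<Rightarrow> 'b"
  assumes "compact S" "closed S" "S \<noteq> {}"
    and clos: "\<And>s x. s \<in> S \<Longrightarrow> x \<in> S \<Longrightarrow> f s x \<in> S"
  obtains L where "closed_left_ideal f S L"
    "\<And>M. closed_left_ideal f S M \<Longrightarrow> M \<subseteq> L \<Longrightarrow> M = L"
proof -
  let ?A = "Collect (closed_left_ideal f S)"
  have S: "closed_left_ideal f S S"
    using assms by (simp add: closed_left_ideal_def)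
  have "\<exists>L\<in>?A. \<forall>M\<in>?A. L \<supseteq> M \<longrightarrow> M = L"
  proof (rule predicate_Zorn)
    show "partial_order_on (?A) (relation_of (\<supseteq>) (?A))"
      by (rule partial_order_on_relation_ofI) auto
  next
    fix C assume C: "C \<in> Chains (relation_of (\<supseteq>) (?A))"
    then have ideals: "closed_left_ideal f S L" if "L \<in> C" for L
      using that Chains_relation_of by blast
    have chain: "L \<subseteq> M \<or> M \<subseteq> L" if "L \<in> C" "M \<in> C" for L M
      using C that by (auto simp: Chains_def relation_of_def)
    have finite_Inter: "F = {} \<or> \<Inter>F \<in> F" if "finite F" "F \<subseteq> C" for F
      using that
    proof (induction F)
      case (insert L F)
      show ?case
      proof (cases "F = {}")
        case False
        with insert have "\<Inter>F \<in> F" by blast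
        moreover from this insert.prems have "L \<subseteq> \<Inter>F \<or> \<Inter>F \<subseteq> L"
          using chain[of L "\<Inter>F"] by blast
        then have "\<Inter>(insert L F) = L \<or> \<Inter>(insert L F) = \<Inter>F"
          by (auto simp only: Inter_insert Int_absorb1 Int_absorb2)
        ultimately show ?thesis by (metis insertCI)
      qed simp
    qed simp
    have "S \<inter> \<Inter>C \<noteq> {}"
    proof (rule compact_imp_fip[OF \<open>compact S\<close>])
      show "closed L" if "L \<in> C" for L
        using ideals[OF that] by (simp add: closed_left_ideal_def)
      show "S \<inter> \<Inter>F \<noteq> {}" if "finite F" "F \<subseteq> C" for F
      proof (cases "F = {}")
        case False
        with finite_Inter[OF that] that have "closed_left_ideal f S (\<Inter>F)"
          using ideals by blast
        then show ?thesis by (auto simp: closed_left_ideal_def)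
      qed (use \<open>S \<noteq> {}\<close> in simp)
    qed
    \<comment> \<open>Intersecting with \<open>S\<close> covers the empty chain as well.\<close>
    then have "closed_left_ideal f S (S \<inter> \<Inter>C)"
      using ideals \<open>closed S\<close> clos by (auto simp: closed_left_ideal_def intro!: closed_Inter)
    then show "\<exists>L\<in>?A. \<forall>M\<in>C. M \<supseteq> L"
      by (intro bexI[of _ "S \<inter> \<Inter>C"]) auto
  qed
  then show thesis
    using that by blast
qed

text \<open>
  A minimal closed left ideal \<open>L\<close> lies in every two-sided ideal \<open>I\<close>: for \<open>i \<in> I\<close> and \<open>p \<in> L\<close>, the
  set \<open>S i p\<close> is a left ideal contained in both \<open>I\<close> and \<open>L\<close>, and it is closed as a continuous image
  of a compact set in a Hausdorff space; by minimality it is all of \<open>L\<close>.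
\<close>

lemma Inter_two_sided_ideals_nonempty:
  fixes f :: "'b::t2_space \<Rightarrow> 'b \<Rightarrow> 'b"
  assumes "compact S" "S \<noteq> {}"
    and clos: "\<And>s x. s \<in> S \<Longrightarrow> x \<in> S \<Longrightarrow> f s x \<in> S"
    and assoc: "\<And>x y z. x \<in> S \<Longrightarrow> y \<in> S \<Longrightarrow> z \<in> S \<Longrightarrow> f (f x y) z = f x (f y z)"
    and cont: "\<And>q. q \<in> S \<Longrightarrow> continuous_on S (\<lambda>p. f p q)"
  shows "\<Inter>{I. two_sided_ideal f S I} \<noteq> {}"
proof -
  obtain L where left_ideal: "closed_left_ideal f S L"
    and minimal: "\<And>M. closed_left_ideal f S M \<Longrightarrow> M \<subseteq> L \<Longrightarrow> M = L"
    by (rule minimal_closed_left_ideal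
        [OF \<open>compact S\<close> compact_imp_closed[OF \<open>compact S\<close>] \<open>S \<noteq> {}\<close>, of f])
      (use clos in auto)
  then have L: "L \<noteq> {}" "L \<subseteq> S" "\<forall>s\<in>S. \<forall>x\<in>L. f s x \<in> L"
    by (auto simp: closed_left_ideal_def)
  have "L \<subseteq> I" if I: "two_sided_ideal f S I" for I
  proof -
    obtain i p where ip: "i \<in> I" "i \<in> S" "p \<in> L" "p \<in> S"
      using I L unfolding two_sided_ideal_def by blast
    let ?q = "f i p"
    have q: "?q \<in> I" "?q \<in> L" "?q \<in> S"
      using ip I L by (auto simp: two_sided_ideal_def)
    let ?M = "(\<lambda>s. f s ?q) ` S"
    have "closed ?M"
      using cont[OF q(3)] \<open>compact S\<close> by (intro compact_imp_closed compact_continuous_image)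
    moreover have "f s x \<in> ?M" if "s \<in> S" "x \<in> ?M" for s x
    proof -
      obtain t where t: "t \<in> S" "x = f t ?q"
        using \<open>x \<in> ?M\<close> by blast
      then have "f s x = f (f s t) ?q"
        using that q by (simp add: assoc)
      with t \<open>s \<in> S\<close> show ?thesis
        by (metis clos imageI)
    qed
    moreover have "?M \<subseteq> L"
      using L q by auto
    moreover from this have "?M \<subseteq> S"
      using L by simp
    ultimately have "closed_left_ideal f S ?M"
      using \<open>S \<noteq> {}\<close> by (simp add: closed_left_ideal_def)
    with \<open>?M \<subseteq> L\<close> have "?M = L"
      by (intro minimal)
    moreover have "?M \<subseteq> I"
      using I q by (auto simp: two_sided_ideal_def)
    ultimately show ?thesis by blast
  qed
  with \<open>L \<noteq> {}\<close> show ?thesis by blast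
qed

lemma smallest_ideal_subset:
  fixes f :: "'b::t2_space \<Rightarrow> 'b \<Rightarrow> 'b"
  assumes "compact S" "S \<noteq> {}"
    and clos: "\<And>s x. s \<in> S \<Longrightarrow> x \<in> S \<Longrightarrow> f s x \<in> S"
    and assoc: "\<And>x y z. x \<in> S \<Longrightarrow> y \<in> S \<Longrightarrow> z \<in> S \<Longrightarrow> f (f x y) z = f x (f y z)"
    and cont: "\<And>q. q \<in> S \<Longrightarrow> continuous_on S (\<lambda>p. f p q)"
    and I: "two_sided_ideal f S I"
  shows "smallest_ideal f S \<subseteq> I"
proof -
  let ?K = "\<Inter>{I. two_sided_ideal f S I}"
  have "?K \<noteq> {}"
    using assms by (intro Inter_two_sided_ideals_nonempty) auto
  moreover have "?K \<subseteq> S"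
    using I by (auto simp: two_sided_ideal_def)
  moreover have "f s x \<in> ?K \<and> f x s \<in> ?K" if "s \<in> S" "x \<in> ?K" for s x
    using that by (simp add: two_sided_ideal_def)
  ultimately have "two_sided_ideal f S ?K"
    unfolding two_sided_ideal_def[of f S ?K] by blast
  then have "smallest_ideal f S = ?K"
    unfolding smallest_ideal_def by (rule Least_equality) blast
  with I show ?thesis by blast
qed

section \<open>Compactness of the space of ultrafilters\<close>

text \<open>
  By Zorn's lemma there is a minimal proper filter below \<open>F\<close>, and minimality forces it to decide
  every predicate \<open>P\<close>: if adjoining \<open>P\<close> keeps it proper, then \<open>P\<close> was there already.
\<close>

lemma ultrafilter_below:
  assumes "F \<noteq> bot"
  obtains p where "Rep_ultrafilter p \<le> F"
proof -
  let ?A = "{G. G \<noteq> bot \<and> G \<le> F}"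
  have "\<exists>G\<in>?A. \<forall>G'\<in>?A. G \<ge> G' \<longrightarrow> G' = G"
  proof (rule predicate_Zorn)
    show "partial_order_on ?A (relation_of (\<ge>) ?A)"
      by (rule partial_order_on_relation_ofI) auto
  next
    fix C assume C: "C \<in> Chains (relation_of (\<ge>) ?A)"
    then have "C \<subseteq> ?A"
      by (rule Chains_relation_of)
    have chain: "G \<le> G' \<or> G' \<le> G" if "G \<in> C" "G' \<in> C" for G G'
      using C that by (auto simp: Chains_def relation_of_def)
    show "\<exists>G\<in>?A. \<forall>G'\<in>C. G' \<ge> G"
    proof (cases "C = {}")
      case False
      have "eventually P (Inf C) \<longleftrightarrow> (\<exists>G\<in>C. eventually P G)" for P
      proof (rule eventually_Inf_base[OF False])
        show "\<exists>H\<in>C. H \<le> inf G G'" if "G \<in> C" "G' \<in> C" for G G'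
          using chain[OF that] that by (metis inf.absorb1 inf.absorb2 order_refl)
      qed
      then have "Inf C \<noteq> bot"
        using \<open>C \<subseteq> ?A\<close> by (auto simp: trivial_limit_def)
      moreover have "Inf C \<le> F"
      proof -
        obtain G where "G \<in> C"
          using False by blast
        moreover from this \<open>C \<subseteq> ?A\<close> have "G \<le> F" by blast
        ultimately show ?thesis by (rule Inf_lower2)
      qed
      ultimately show ?thesis
        by (intro bexI[of _ "Inf C"]) (auto intro: Inf_lower)
    qed (use assms in auto)
  qed
  then obtain G where G: "G \<noteq> bot" "G \<le> F"
    and minimal_below: "\<forall>G'\<in>?A. G \<ge> G' \<longrightarrow> G' = G"
    by blast
  have minimal: "G' = G" if "G' \<noteq> bot" "G' \<le> G" for G'
    using minimal_below that order_trans[OF that(2) G(2)] by simp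
  have "eventually P G \<or> eventually (\<lambda>x. \<not> P x) G" for P
  proof (cases "inf G (principal {x. P x}) = bot")
    case True
    then show ?thesis
      by (simp add: trivial_limit_def eventually_inf_principal)
  next
    case False
    with minimal have "inf G (principal {x. P x}) = G" by simp
    then have "G \<le> principal {x. P x}"
      by (metis inf.cobounded2)
    then show ?thesis by (simp add: le_principal)
  qed
  with G have "Rep_ultrafilter (Abs_ultrafilter G) = G"
    by (intro Abs_ultrafilter_inverse) simp
  with G that show thesis by metis
qed

text \<open>
  The complements of the members have the finite intersection property and so generate a proper
  filter.
\<close>

lemma ultrafilter_avoiding_family:
  assumes "\<And>\<B>. finite \<B> \<Longrightarrow> \<B> \<subseteq> \<A> \<Longrightarrow> \<Union>\<B> \<noteq> UNIV"
  shows "\<exists>p. \<forall>A\<in>\<A>. \<not> in_ultrafilter A p"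
proof -
  let ?F = "INF A\<in>\<A>. principal (- A)"
  have "?F \<noteq> bot"
  proof (rule Inf_filter_not_bot)
    fix X assume X: "X \<subseteq> (\<lambda>A. principal (- A)) ` \<A>" "finite X"
    then obtain \<B> where \<B>: "\<B> \<subseteq> \<A>" "finite \<B>" "X = (\<lambda>A. principal (- A)) ` \<B>"
      by (meson finite_subset_image)
    then have "Inf X = principal (\<Inter>A\<in>\<B>. - A)"
      by (simp add: INF_principal_finite)
    moreover have "(\<Inter>A\<in>\<B>. - A) \<noteq> {}"
      using assms[OF \<B>(2,1)] by auto
    ultimately show "Inf X \<noteq> bot"
      by (simp add: principal_eq_bot_iff)
  qed
  then obtain p where p: "Rep_ultrafilter p \<le> ?F"
    by (rule ultrafilter_below)
  have "\<not> in_ultrafilter A p" if "A \<in> \<A>" for A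
  proof -
    have "Rep_ultrafilter p \<le> principal (- A)"
      using p INF_lower[OF that] by (rule order_trans)
    then have "in_ultrafilter (- A) p"
      by (simp add: le_principal in_ultrafilter_def)
    then show ?thesis
      by (simp add: in_ultrafilter_Compl)
  qed
  then show ?thesis by blast
qed

lemma in_ultrafilter_mono: "in_ultrafilter A p \<Longrightarrow> A \<subseteq> B \<Longrightarrow> in_ultrafilter B p"
  unfolding in_ultrafilter_def by (erule eventually_mono) blast

lemma in_ultrafilter_empty: "\<not> in_ultrafilter {} p"
  using in_ultrafilter_Compl[of UNIV p] by (simp add: in_ultrafilter_UNIV)

lemma open_hat: "open (hat A)"
  unfolding open_ultrafilter_def by (rule exI[of _ "{A}"]) simp

lemma hat_Compl: "hat (- A) = - hat A"
  by (auto simp: hat_def in_ultrafilter_Compl)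

lemma closed_hat: "closed (hat A)"
  using open_hat[of "- A"] by (simp add: closed_def hat_Compl)

instance ultrafilter :: (type) t2_space
proof
  fix p q :: "'a ultrafilter"
  assume "p \<noteq> q"
  then obtain A where "in_ultrafilter A p \<noteq> in_ultrafilter A q"
    using ultrafilter_eqI by blast
  then obtain B where "in_ultrafilter B p" "in_ultrafilter (- B) q"
    by (metis in_ultrafilter_Compl)
  then have "open (hat B) \<and> open (hat (- B)) \<and> p \<in> hat B \<and> q \<in> hat (- B) \<and>
      hat B \<inter> hat (- B) = {}"
    by (intro conjI open_hat) (auto simp: hat_def in_ultrafilter_Compl)
  then show "\<exists>U V. open U \<and> open V \<and> p \<in> U \<and> q \<in> V \<and> U \<inter> V = {}"
    by (intro exI)
qed

text \<open>
  Given an open cover, collect the sets \<open>A\<close> for which \<^term>\<open>hat A\<close> fits into a member.  If the cover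
  has no finite subcover, then finitely many such \<open>A\<close> never exhaust the type, so some ultrafilter
  avoids all of them and is not covered.
\<close>

lemma compact_UNIV_ultrafilter: "compact (UNIV :: 'a ultrafilter set)"
proof (rule compactI, rule ccontr)
  fix \<C> :: "'a ultrafilter set set"
  assume opn: "\<forall>U\<in>\<C>. open U" and cover: "UNIV \<subseteq> \<Union>\<C>"
    and no_subcover: "\<not> (\<exists>\<C>'\<subseteq>\<C>. finite \<C>' \<and> UNIV \<subseteq> \<Union>\<C>')"
  let ?\<A> = "{A. \<exists>U\<in>\<C>. hat A \<subseteq> U}"
  have "\<exists>p. \<forall>A\<in>?\<A>. \<not> in_ultrafilter A p"
  proof (rule ultrafilter_avoiding_family, rule notI)
    fix \<B> assume \<B>: "finite \<B>" "\<B> \<subseteq> ?\<A>"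
    assume "\<Union>\<B> = UNIV"
    have "\<forall>A\<in>\<B>. \<exists>U. U \<in> \<C> \<and> hat A \<subseteq> U"
      using \<B>(2) by blast
    from bchoice[OF this] obtain u where u: "\<And>A. A \<in> \<B> \<Longrightarrow> u A \<in> \<C> \<and> hat A \<subseteq> u A"
      by blast
    have "p \<in> \<Union>(u ` \<B>)" for p
    proof (rule ccontr)
      assume "p \<notin> \<Union>(u ` \<B>)"
      then have "in_ultrafilter (- A) p" if "A \<in> \<B>" for A
        using u[OF that] that by (auto simp: hat_def in_ultrafilter_Compl)
      then have "in_ultrafilter (\<Inter>A\<in>\<B>. - A) p"
        using \<B>(1) by (simp add: in_ultrafilter_def eventually_ball_finite)
      moreover have "(\<Inter>A\<in>\<B>. - A) = {}"
        using \<open>\<Union>\<B> = UNIV\<close> by blast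
      ultimately show False
        by (simp add: in_ultrafilter_empty)
    qed
    then have "u ` \<B> \<subseteq> \<C> \<and> finite (u ` \<B>) \<and> UNIV \<subseteq> \<Union>(u ` \<B>)"
      using \<B>(1) u by blast
    with no_subcover show False by blast
  qed
  then obtain p where p: "\<forall>A\<in>?\<A>. \<not> in_ultrafilter A p" ..
  obtain U where "U \<in> \<C>" "p \<in> U"
    using cover by blast
  with opn obtain \<A> where "U = (\<Union>A\<in>\<A>. hat A)"
    by (auto simp: open_ultrafilter_def)
  with \<open>p \<in> U\<close> obtain A where "p \<in> hat A" "hat A \<subseteq> U"
    by auto
  with \<open>U \<in> \<C>\<close> have "\<not> in_ultrafilter A p"
    using p by blast
  with \<open>p \<in> hat A\<close> show False
    by (simp add: hat_def)
qed

section \<open>The semigroup of ultrafilters\<close>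

lemma ext_op_assoc:
  assumes "\<And>x y z. f (f x y) z = f x (f y z)"
  shows "ext_op f (ext_op f p q) r = ext_op f p (ext_op f q r)"
  by (rule ultrafilter_eqI) (simp add: in_ultrafilter_ext_op assms)

lemma continuous_on_ext_op_left: "continuous_on S (\<lambda>p. ext_op f p q)"
proof -
  have "open ((\<lambda>p. ext_op f p q) -` U)" if "open U" for U
  proof -
    from that have "\<exists>\<A>. U = (\<Union>A\<in>\<A>. hat A)"
      by (simp only: open_ultrafilter_def)
    then obtain \<A> where "U = (\<Union>A\<in>\<A>. hat A)" ..
    moreover have "(\<lambda>p. ext_op f p q) -` hat A = hat {s. in_ultrafilter {x. f s x \<in> A} q}" for A
      by (simp add: hat_def in_ultrafilter_ext_op vimage_def)
    ultimately have "(\<lambda>p. ext_op f p q) -` U =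
        (\<Union>A\<in>\<A>. hat {s. in_ultrafilter {x. f s x \<in> A} q})"
      by (simp add: vimage_UN)
    then show ?thesis
      by (simp add: open_UN open_hat)
  qed
  then have "continuous_on UNIV (\<lambda>p. ext_op f p q)"
    by (simp add: continuous_on_open_vimage)
  then show ?thesis
    by (rule continuous_on_subset) simp
qed

lemma smallest_ideal_ext_op_subset:
  assumes "closed S" "S \<noteq> {}"
    and clos: "\<And>p q. p \<in> S \<Longrightarrow> q \<in> S \<Longrightarrow> ext_op f p q \<in> S"
    and assoc: "\<And>x y z. f (f x y) z = f x (f y z)"
    and "two_sided_ideal (ext_op f) S I"
  shows "smallest_ideal (ext_op f) S \<subseteq> I"
proof -
  have "compact S"
    using compact_Int_closed[OF compact_UNIV_ultrafilter \<open>closed S\<close>] by simp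
  from this \<open>S \<noteq> {}\<close> clos ext_op_assoc[of f, OF assoc] continuous_on_ext_op_left
    \<open>two_sided_ideal (ext_op f) S I\<close>
  show ?thesis
    by (rule smallest_ideal_subset)
qed

lemma hat_singleton: "hat {a} = {principal_ultrafilter a}"
proof -
  have "p = principal_ultrafilter a" if p: "in_ultrafilter {a} p" for p
  proof (rule ultrafilter_eqI)
    fix A
    show "in_ultrafilter A p \<longleftrightarrow> in_ultrafilter A (principal_ultrafilter a)"
      using in_ultrafilter_mono[OF p, of A] in_ultrafilter_mono[OF p, of "- A"]
      by (cases "a \<in> A") (auto simp: in_ultrafilter_principal in_ultrafilter_Compl)
  qed
  then show ?thesis
    by (auto simp: hat_def in_ultrafilter_principal)
qed

section \<open>Ultrafilters containing no coset of a subgroup\<close>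

text \<open>
  For the right factor: the translate \<open>-t + (x + H)\<close> belongs to \<open>q\<close> only if it is the single coset
  of \<open>H\<close> in \<open>q\<close>, if there is one; and the \<open>t\<close> for which this happens form a coset again, which \<open>p\<close>
  does not contain.
\<close>

lemma coset_avoiding_ultrafilters_ideal:
  fixes H :: "'a::ab_group_add set"
  assumes H0: "0 \<in> H" and diff: "\<And>x y. x \<in> H \<Longrightarrow> y \<in> H \<Longrightarrow> x - y \<in> H"
    and inf_index: "\<not> finite_index H"
  shows "two_sided_ideal (ext_op (+)) UNIV {p. \<forall>x. \<not> in_ultrafilter (x +o H) p}"
    (is "two_sided_ideal _ _ ?I")
proof -
  have mem_coset: "y \<in> x +o H \<longleftrightarrow> y - x \<in> H" for x y
    by (force simp: elt_set_plus_def)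
  have uminus: "- x \<in> H" if "x \<in> H" for x
    using diff[OF H0 that] by simp
  have add: "x + y \<in> H" if "x \<in> H" "y \<in> H" for x y
    using diff[OF that(1) uminus[OF that(2)]] by simp
  have coset_eq: "x +o H = y +o H" if "z \<in> x +o H" "z \<in> y +o H" for x y z
  proof -
    have "x - y \<in> H"
      using that diff[of "z - y" "z - x"] by (simp add: mem_coset)
    then have "w - x \<in> H \<longleftrightarrow> w - y \<in> H" for w
      using add[of "w - x" "x - y"] diff[of "w - y" "x - y"] by auto
    then show ?thesis
      by (auto simp: mem_coset)
  qed
  have translate: "{t. s + t \<in> x +o H} = (x - s) +o H" for s x
    by (auto simp: mem_coset algebra_simps)
  have "?I \<noteq> {}"
  proof -
    have "\<exists>p. \<forall>A\<in>range (\<lambda>x. x +o H). \<not> in_ultrafilter A p"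
    proof (rule ultrafilter_avoiding_family, rule notI)
      fix \<B> assume \<B>: "finite \<B>" "\<B> \<subseteq> range (\<lambda>x. x +o H)"
      assume cover: "\<Union>\<B> = UNIV"
      have "x +o H \<in> \<B>" for x
      proof -
        obtain B where B: "B \<in> \<B>" "x \<in> B"
          using cover by blast
        then obtain y where "B = y +o H"
          using \<B>(2) by blast
        then show ?thesis
          using B coset_eq[of x x y] H0 by (simp add: mem_coset)
      qed
      then have "finite (range (\<lambda>x. x +o H))"
        by (intro finite_subset[OF _ \<B>(1)]) blast
      with inf_index show False
        by (simp add: finite_index_def)
    qed
    then show ?thesis by auto
  qed
  moreover have "ext_op (+) q p \<in> ?I" if "p \<in> ?I" for p q
    using that by (simp add: in_ultrafilter_ext_op translate in_ultrafilter_empty)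
  moreover have "ext_op (+) p q \<in> ?I" if p: "p \<in> ?I" for p q
  proof -
    have "\<not> in_ultrafilter {s. in_ultrafilter ((x - s) +o H) q} p" for x
    proof (cases "\<exists>y. in_ultrafilter (y +o H) q")
      case True
      then obtain y where y: "in_ultrafilter (y +o H) q" ..
      have "{s. in_ultrafilter ((x - s) +o H) q} \<subseteq> (x - y) +o H"
      proof
        fix s assume "s \<in> {s. in_ultrafilter ((x - s) +o H) q}"
        with y have "in_ultrafilter (((x - s) +o H) \<inter> (y +o H)) q"
          by (simp add: in_ultrafilter_Int)
        then have "((x - s) +o H) \<inter> (y +o H) \<noteq> {}"
          using in_ultrafilter_empty by metis
        then have "y +o H = (x - s) +o H"
          using coset_eq by blast
        then have "x - s - y \<in> H"
          using H0 by (metis mem_coset diff_self)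
        then show "s \<in> (x - y) +o H"
          using uminus[of "x - s - y"] by (simp add: mem_coset algebra_simps)
      qed
      with p show ?thesis
        by (auto dest: in_ultrafilter_mono)
    next
      case False
      then show ?thesis
        by (simp add: in_ultrafilter_empty)
    qed
    then show ?thesis
      by (simp add: in_ultrafilter_ext_op translate)
  qed
  ultimately show ?thesis
    by (simp add: two_sided_ideal_def)
qed

lemma hat_disjoint_closure_smallest_additive_ideal:
  fixes H :: "'a::ab_group_add set"
  assumes "0 \<in> H" "\<And>x y. x \<in> H \<Longrightarrow> y \<in> H \<Longrightarrow> x - y \<in> H" "\<not> finite_index H"
  shows "hat H \<inter> closure (smallest_ideal (ext_op (+)) UNIV) = {}"
proof -
  have "smallest_ideal (ext_op (+)) UNIV \<subseteq> {p. \<forall>x. \<not> in_ultrafilter (x +o H) p}"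
    using coset_avoiding_ultrafilters_ideal[OF assms]
    by (intro smallest_ideal_ext_op_subset) (auto simp: add.assoc)
  moreover have "p \<notin> hat H" if "\<forall>x. \<not> in_ultrafilter (x +o H) p" for p
    using that[THEN spec, of 0] by (simp add: hat_def elt_set_plus_def)
  ultimately have "hat H \<inter> smallest_ideal (ext_op (+)) UNIV = {}"
    by blast
  then show ?thesis
    by (simp add: open_Int_closure_eq_empty[OF open_hat])
qed

section \<open>Ultrafilters containing a ring ideal\<close>

lemma closure_smallest_multiplicative_ideal_subset_hat:
  fixes J :: "'a::ring_no_zero_divisors set"
  assumes absorb: "\<And>s x. x \<in> J \<Longrightarrow> s * x \<in> J \<and> x * s \<in> J"
    and a: "a \<in> J" "a \<noteq> 0"
  shows "closure (smallest_ideal (ext_op (*)) (- {principal_ultrafilter 0})) \<subseteq> hat J"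
proof (rule closure_minimal[OF _ closed_hat])
  let ?S = "- {principal_ultrafilter (0::'a)}"
  have "two_sided_ideal (ext_op (*)) ?S (hat J \<inter> ?S)"
    unfolding two_sided_ideal_def
  proof (intro conjI ballI)
    have "principal_ultrafilter a \<noteq> principal_ultrafilter 0"
      using a(2) in_ultrafilter_principal[of "{0}" a] in_ultrafilter_principal[of "{0}" 0] by auto
    moreover have "principal_ultrafilter a \<in> hat J"
      using a(1) by (simp add: hat_def in_ultrafilter_principal)
    ultimately show "hat J \<inter> ?S \<noteq> {}" by blast
  next
    fix q p assume q: "q \<in> ?S" and p: "p \<in> hat J \<inter> ?S"
    from p have J: "in_ultrafilter J p"
      by (simp add: hat_def)
    have "in_ultrafilter {x. s * x \<in> J} p" for s
      using absorb by (intro in_ultrafilter_mono[OF J]) blast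
    then show "ext_op (*) q p \<in> hat J \<inter> ?S"
      using p q ext_op_times_neq_principal_0[of q p]
      by (simp add: hat_def in_ultrafilter_ext_op in_ultrafilter_UNIV)
    have "{x. s * x \<in> J} = UNIV" if "s \<in> J" for s
      using absorb[OF that] by blast
    then have "in_ultrafilter {s. in_ultrafilter {x. s * x \<in> J} q} p"
      by (intro in_ultrafilter_mono[OF J]) (auto simp: in_ultrafilter_UNIV)
    then show "ext_op (*) p q \<in> hat J \<inter> ?S"
      using p q ext_op_times_neq_principal_0[of p q]
      by (simp add: hat_def in_ultrafilter_ext_op)
  qed simp
  moreover from this have "?S \<noteq> {}"
    by (auto simp: two_sided_ideal_def)
  moreover have "closed ?S"
    using open_hat[of "{0::'a}"] by (simp add: hat_singleton closed_def)
  ultimately have "smallest_ideal (ext_op (*)) ?S \<subseteq> hat J \<inter> ?S"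
    using ext_op_times_neq_principal_0
    by (intro smallest_ideal_ext_op_subset) (auto simp: mult.assoc)
  then show "smallest_ideal (ext_op (*)) ?S \<subseteq> hat J" by blast
qed

theorem theorem32:
  fixes r0 :: "'a::{comm_ring, ring_no_zero_divisors}"
  assumes "infinite (UNIV :: 'a set)"
    and "\<not> homomorphically_finite TYPE('a)"
    and "r0 \<noteq> 0"
    and "\<not> finite_index (r0 *o UNIV)"
  shows "closure (smallest_ideal (ext_op (*)) (- {principal_ultrafilter (0::'a)}))
           \<subseteq> hat (r0 *o UNIV) \<and>
         hat (r0 *o UNIV) \<inter> closure (smallest_ideal (ext_op (+)) UNIV) = {} \<and>
         closure (smallest_ideal (ext_op (*)) (- {principal_ultrafilter (0::'a)}))
           \<inter> closure (smallest_ideal (ext_op (+)) UNIV) = {}"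
proof -
  have ideal: "r0 *o UNIV = range ((*) r0)"
    by (auto simp: elt_set_times_def)
  have "closure (smallest_ideal (ext_op (*)) (- {principal_ultrafilter (0::'a)}))
      \<subseteq> hat (r0 *o UNIV)"
  proof (rule closure_smallest_multiplicative_ideal_subset_hat)
    \<comment> \<open>Without a unit, \<open>r0\<close> itself may fail to lie in \<open>r0 R\<close>, but its square does.\<close>
    show "r0 * r0 \<in> r0 *o UNIV" "r0 * r0 \<noteq> 0"
      using \<open>r0 \<noteq> 0\<close> by (auto simp: ideal)
    show "s * x \<in> r0 *o UNIV \<and> x * s \<in> r0 *o UNIV" if x: "x \<in> r0 *o UNIV" for s x
    proof -
      obtain y where "x = r0 * y"
        using x by (auto simp: ideal)
      then have "s * x = r0 * (s * y)" "x * s = r0 * (y * s)"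
        by (simp_all add: ac_simps)
      then show ?thesis
        unfolding ideal by blast
    qed
  qed
  moreover have "hat (r0 *o UNIV) \<inter> closure (smallest_ideal (ext_op (+)) UNIV) = {}"
  proof (rule hat_disjoint_closure_smallest_additive_ideal)
    show "0 \<in> r0 *o UNIV"
      unfolding ideal by (rule range_eqI[of _ _ 0]) simp
    show "x - y \<in> r0 *o UNIV" if "x \<in> r0 *o UNIV" "y \<in> r0 *o UNIV" for x y
      using that by (auto simp: ideal simp flip: right_diff_distrib)
  qed fact
  ultimately show ?thesis by blast
qed

end
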